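(* Let $B$ be a two-sided skew brace (not necessarily finite). Then $B$ is solvable if and only if there exists an ideal $I$ of $B$ such that $I$, regarded as a skew brace in its own right, and $B/I$ are both solvable.
   Context: A skew brace is a triple $B=(B,+,\cdot)$ such that $(B,+)$ and $(B,\cdot)$ are groups (neither assumed abelian) on the same underlying set and $a\cdot(b+c)=a\cdot b-a+a\cdot c$ for all $a,b,c\in B$. It is two-sided if moreover $(a+b)\cdot c=a\cdot c-c+b\cdot c$ for all $a,b,c\in B$. The two identity elements coincide and are denoted by $0$. For $a\in B$, $\lambda_a(b)=-a+a\cdot b$ defines an automorphism of $(B,+)$. A left ideal of $B$ is a subgroup $I\leq (B,+)$ with $\lambda_b(I)=I$ for every $b\in B$. An ideal of $B$ is a left ideal that is normal in both $(B,+)$ and $(B,\cdot)$; an ideal is a skew brace under the restricted operations, and $B/I$ is a skew brace under $(a+I)+(b+I)=a+b+I$, $(a+I)\cdot(b+I)=a\cdot b+I$. For a skew brace $A$ and ideals $I,J$ of $A$, the commutator $[I,J]_A$ is the ideal of $A$ generated by $[I,J]_+\cup[I,J]_\cdot\cup\{\,i\cdot j-(i+j)\mid i\in I,\ j\in J\,\}$, where $[I,J]_+$ and $[I,J]_\cdot$ are the commutator subgroups taken in $(A,+)$ and $(A,\cdot)$. The derived series of $A$ is $\partial^0(A)=A$, $\partial^{n+1}(A)=[\partial^n(A),\partial^n(A)]_A$. The skew brace $A$ is solvable if $\partial^n(A)=0$ for some $n\geq 0$. For $I$ regarded as a skew brace in its own right, solvability is this notion with $A=I$ (commutators being ideals of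 $I$). *)

theory Defs
  imports "HOL-Algebra.QuotRing" "HOL-Algebra.Generated_Groups"
begin

text \<open>
  The record type of rings from HOL-Algebra serves as the signature of skew braces: a carrier with
  two operations, where \<open>add_monoid B\<close> is the additive group and \<open>B\<close> itself, read as a monoid record,
  is the multiplicative group. Neither group is assumed commutative, and no ring axioms are
  assumed. That \<open>\<zero>\<close> and \<open>\<one>\<close> coincide is a consequence of the axioms.
\<close>

locale skew_brace =
  fixes B :: "('a, 'b) ring_scheme" (structure)
  assumes add_group: "group (add_monoid B)"
    and mult_group: "group B"
    and left_compat: "\<lbrakk> a \<in> carrier B; b \<in> carrier B; c \<in> carrier B \<rbrakk>
      \<Longrightarrow> a \<otimes> (b \<oplus> c) = a \<otimes> b \<ominus> a \<oplus> a \<otimes> c"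

locale two_sided_skew_brace = skew_brace +
  assumes right_compat: "\<lbrakk> a \<in> carrier B; b \<in> carrier B; c \<in> carrier B \<rbrakk>
      \<Longrightarrow> (a \<oplus> b) \<otimes> c = a \<otimes> c \<ominus> c \<oplus> b \<otimes> c"

definition brace_lambda :: "('a, 'b) ring_scheme \<Rightarrow> 'a \<Rightarrow> 'a \<Rightarrow> 'a" where
  "brace_lambda B a b = \<ominus>\<^bsub>B\<^esub> a \<oplus>\<^bsub>B\<^esub> a \<otimes>\<^bsub>B\<^esub> b"

definition left_brace_ideal :: "('a, 'b) ring_scheme \<Rightarrow> 'a set \<Rightarrow> bool" where
  "left_brace_ideal B I \<longleftrightarrow>
     subgroup I (add_monoid B) \<and> (\<forall>b \<in> carrier B. brace_lambda B b ` I = I)"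

definition brace_ideal :: "('a, 'b) ring_scheme \<Rightarrow> 'a set \<Rightarrow> bool" where
  "brace_ideal B I \<longleftrightarrow> left_brace_ideal B I \<and> I \<lhd> add_monoid B \<and> I \<lhd> B"

definition brace_ideal_generated :: "('a, 'b) ring_scheme \<Rightarrow> 'a set \<Rightarrow> 'a set" where
  "brace_ideal_generated B S = \<Inter>{K. brace_ideal B K \<and> S \<subseteq> K}"

definition commutator_subgroup :: "('a, 'b) monoid_scheme \<Rightarrow> 'a set \<Rightarrow> 'a set \<Rightarrow> 'a set" where
  "commutator_subgroup G H K =
     generate G {h \<otimes>\<^bsub>G\<^esub> k \<otimes>\<^bsub>G\<^esub> inv\<^bsub>G\<^esub> h \<otimes>\<^bsub>G\<^esub> inv\<^bsub>G\<^esub> k | h k. h \<in> H \<and> k \<in> K}"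

definition brace_commutator :: "('a, 'b) ring_scheme \<Rightarrow> 'a set \<Rightarrow> 'a set \<Rightarrow> 'a set" where
  "brace_commutator A I J = brace_ideal_generated A
     (commutator_subgroup (add_monoid A) I J \<union> commutator_subgroup A I J \<union>
      {i \<otimes>\<^bsub>A\<^esub> j \<ominus>\<^bsub>A\<^esub> (i \<oplus>\<^bsub>A\<^esub> j) | i j. i \<in> I \<and> j \<in> J})"

primrec brace_derived :: "('a, 'b) ring_scheme \<Rightarrow> nat \<Rightarrow> 'a set" where
  "brace_derived A 0 = carrier A"
| "brace_derived A (Suc n) = brace_commutator A (brace_derived A n) (brace_derived A n)"

definition brace_solvable :: "('a, 'b) ring_scheme \<Rightarrow> bool" where
  "brace_solvable A \<longleftrightarrow> (\<exists>n. brace_derived A n = {\<zero>\<^bsub>A\<^esub>})"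

text \<open>
  The quotient of a skew brace by an ideal is rendered by the library's \<open>B Quot I\<close>, whose definition
  needs only the two operations and represents cosets as \<open>I +> a\<close>. The following facts show that it
  is the expected structure.
\<close>

lemma (in skew_brace) Quot_carrier:
  assumes "brace_ideal B I"
  shows "carrier (B Quot I) = {{a \<oplus> i | i. i \<in> I} | a. a \<in> carrier B}"
proof -
  interpret n: normal I "add_monoid B"
    using assms by (simp add: brace_ideal_def)
  have "I #>\<^bsub>add_monoid B\<^esub> a = {a \<oplus> i | i. i \<in> I}" if "a \<in> carrier B" for a
    using n.coset_eq that by (auto simp: l_coset_def)
  then show ?thesis
    by (auto simp: FactRing_def A_RCOSETS_def RCOSETS_def)
qed

lemma (in skew_brace) coset_add_eq_mult:
  assumes "brace_ideal B I" "a \<in> carrier B"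
  shows "I +> a = a <# I"
proof -
  interpret n: normal I "add_monoid B"
    using assms by (simp add: brace_ideal_def)
  interpret M: group B by (rule mult_group)
  have l: "brace_lambda B a ` I = I"
    using assms by (simp add: brace_ideal_def left_brace_ideal_def)
  have e: "a \<oplus> brace_lambda B a i = a \<otimes> i" if "i \<in> I" for i
  proof -
    have i: "i \<in> carrier B" using n.subset that by auto
    have "a \<oplus> (\<ominus> a \<oplus> a \<otimes> i) = a \<otimes> i"
      using n.m_assoc[of a "\<ominus> a" "a \<otimes> i"] n.inv_closed[of a] n.r_inv[of a] n.l_one[of "a \<otimes> i"]
        M.m_closed[OF assms(2) i] assms(2)
      by (simp add: a_inv_def)
    then show ?thesis by (simp add: brace_lambda_def)
  qed
  have "I +> a = (\<lambda>i. a \<oplus> i) ` I"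
    using n.coset_eq assms(2) by (auto simp: a_r_coset_def l_coset_def)
  also have "\<dots> = (\<lambda>i. a \<oplus> brace_lambda B a i) ` I"
    by (subst l[symmetric]) (simp add: image_image)
  also have "\<dots> = (\<lambda>i. a \<otimes> i) ` I"
    using e by (intro image_cong) auto
  finally show ?thesis by (auto simp: l_coset_def)
qed

lemma (in skew_brace) Quot_add:
  assumes "brace_ideal B I" "a \<in> carrier B" "b \<in> carrier B"
  shows "(I +> a) \<oplus>\<^bsub>B Quot I\<^esub> (I +> b) = I +> (a \<oplus> b)"
proof -
  interpret n: normal I "add_monoid B"
    using assms by (simp add: brace_ideal_def)
  show ?thesis
    using n.rcos_sum[of a b] assms by (simp add: FactRing_def set_add_def a_r_coset_def)
qed

lemma (in skew_brace) Quot_mult: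
  assumes "brace_ideal B I" "a \<in> carrier B" "b \<in> carrier B"
  shows "(I +> a) \<otimes>\<^bsub>B Quot I\<^esub> (I +> b) = I +> (a \<otimes> b)"
proof -
  interpret n: normal I B
    using assms by (simp add: brace_ideal_def)
  have c: "I +> x = I #> x" if "x \<in> carrier B" for x
    using coset_add_eq_mult[OF assms(1) that] n.coset_eq that by simp
  have "I #> a \<subseteq> carrier B" "I #> b \<subseteq> carrier B"
    using n.r_coset_subset_G[OF n.subset] assms by auto
  then have "(\<Union>x\<in>I #> a. \<Union>y\<in>I #> b. I +> (x \<otimes> y)) = (\<Union>x\<in>I #> a. \<Union>y\<in>I #> b. I #> (x \<otimes> y))"
    by (intro SUP_cong refl c n.m_closed) auto
  also have "\<dots> = (\<Union>x\<in>I #> a. \<Union>y\<in>I #> b. I #> (a \<otimes> b))"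
  proof (intro SUP_cong refl)
    fix x y assume xy: "x \<in> I #> a" "y \<in> I #> b"
    then have "x \<otimes> y \<in> (I #> a) <#> (I #> b)" by (auto simp: set_mult_def)
    then have "x \<otimes> y \<in> I #> (a \<otimes> b)" using n.rcos_sum assms by simp
    then show "I #> (x \<otimes> y) = I #> (a \<otimes> b)"
      using n.repr_independence n.is_subgroup assms n.m_closed n.subgroup_axioms by metis
  qed
  also have "\<dots> = I #> (a \<otimes> b)"
    using n.rcos_self[OF assms(2)] n.rcos_self[OF assms(3)] n.subgroup_axioms by auto
  finally show ?thesis
    using assms c by (simp add: FactRing_def rcoset_mult_def)
qed

end

theory Submission
  imports Defs
begin

text \<open>
  For an ideal \<open>K\<close> let \<open>N(K)\<close> be the additive subgroup generated by the additive commutators of \<open>K\<close>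
  and the elements \<open>i j - (i + j)\<close>; unlike the commutator ideal it does not depend on the ambient
  skew brace. Modulo additive commutators the latter elements are the \<open>\<lambda>\<^sub>i(j) - j\<close>. Since
  \<open>\<lambda>\<^sub>b(\<lambda>\<^sub>i(j) - j) = \<lambda>\<^sub>c(\<lambda>\<^sub>b(j)) - \<lambda>\<^sub>b(j)\<close> with \<open>c = b i b\<^sup>-\<^sup>1\<close>, each \<open>\<lambda>\<^sub>b\<close> preserves \<open>N(K)\<close>, and the same
  argument for the opposite addition shows that \<open>x \<mapsto> b x - b\<close> preserves it, so \<open>N(K)\<close> is normal
  in the additive group. Two-sidedness makes multiplicative conjugations automorphisms of the whole
  skew brace, so \<open>N(K)\<close> is an ideal. Iterating \<open>N\<close> from \<open>I\<close> then gives ideals of \<open>B\<close> between the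
  derived series of \<open>B\<close>, once it has entered \<open>I\<close>, and the derived series of \<open>I\<close> itself.
\<close>

section \<open>Basic identities for the two groups, \<open>brace_lambda\<close> and
  \<open>op_lambda\<close>\<close>

sublocale skew_brace \<subseteq> mult: group B
  by (rule mult_group)

sublocale skew_brace \<subseteq> add: group "add_monoid B"
  rewrites "carrier (add_monoid B) = carrier B"
    and "mult (add_monoid B) = add B"
    and "one (add_monoid B) = zero B"
    and "m_inv (add_monoid B) = a_inv B"
  by (rule add_group) (auto simp: a_inv_def)

context skew_brace
begin

lemma add_inv_cancel:
  assumes "x \<in> carrier B" "y \<in> carrier B"
  shows "x \<oplus> (\<ominus> x \<oplus> y) = y" "\<ominus> x \<oplus> (x \<oplus> y) = y"
  using assms by (simp_all add: add.m_assoc[symmetric])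

lemmas add_group_simps = a_minus_def add.m_assoc add.inv_mult_group add_inv_cancel

lemma one_eq_zero: "\<one> = \<zero>"
proof -
  \<comment> \<open>The left side is 0 and the right side collapses to -1.\<close>
  have "\<one> \<otimes> (\<zero> \<oplus> \<zero>) = \<one> \<otimes> \<zero> \<ominus> \<one> \<oplus> \<one> \<otimes> \<zero>"
    by (rule left_compat) auto
  then have "\<ominus> \<one> = \<zero>"
    by (simp add: a_minus_def)
  then show ?thesis
    by (metis add.inv_inv add.inv_one mult.one_closed)
qed

lemma minus_closed: "x \<in> carrier B \<Longrightarrow> y \<in> carrier B \<Longrightarrow> x \<ominus> y \<in> carrier B"
  by (simp add: a_minus_def)

lemma lambda_closed: "b \<in> carrier B \<Longrightarrow> x \<in> carrier B \<Longrightarrow> brace_lambda B b x \<in> carrier B"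
  by (simp add: brace_lambda_def)

lemma lambda_add:
  assumes "b \<in> carrier B" "x \<in> carrier B" "y \<in> carrier B"
  shows "brace_lambda B b (x \<oplus> y) = brace_lambda B b x \<oplus> brace_lambda B b y"
  using assms by (simp add: brace_lambda_def left_compat add_group_simps)

lemma add_lambda:
  "b \<in> carrier B \<Longrightarrow> x \<in> carrier B \<Longrightarrow> b \<oplus> brace_lambda B b x = b \<otimes> x"
  by (simp add: brace_lambda_def add_group_simps)

text \<open>Left compatibility is applied to a (b x) after writing b x as the sum of b and
  \<open>\<lambda>\<^sub>b(x)\<close>.\<close>

lemma lambda_mult:
  assumes "a \<in> carrier B" "b \<in> carrier B" "x \<in> carrier B"
  shows "brace_lambda B (a \<otimes> b) x = brace_lambda B a (brace_lambda B b x)"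
proof -
  have "(a \<otimes> b) \<otimes> x = a \<otimes> (b \<oplus> brace_lambda B b x)"
    using assms by (simp add: add_lambda mult.m_assoc)
  also have "\<dots> = a \<otimes> b \<ominus> a \<oplus> a \<otimes> brace_lambda B b x"
    using assms by (intro left_compat) (auto simp: lambda_closed)
  finally show ?thesis
    using assms by (simp add: brace_lambda_def[of B "a \<otimes> b"] brace_lambda_def[of B a]
        lambda_closed add_group_simps)
qed

lemma lambda_one: "x \<in> carrier B \<Longrightarrow> brace_lambda B \<one> x = x"
  by (simp add: brace_lambda_def) (simp add: one_eq_zero)

lemma lambda_inv:
  assumes "b \<in> carrier B" "x \<in> carrier B"
  shows "brace_lambda B b (brace_lambda B (inv b) x) = x"
  using assms lambda_mult[of b "inv b" x] lambda_one by simp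

text \<open>The map \<open>x \<mapsto> b x - b\<close> is the \<open>\<lambda>\<close>-map of the skew brace with the opposite addition.\<close>

definition op_lambda :: "'a \<Rightarrow> 'a \<Rightarrow> 'a" where
  "op_lambda b x = b \<otimes> x \<ominus> b"

lemma op_lambda_closed: "b \<in> carrier B \<Longrightarrow> x \<in> carrier B \<Longrightarrow> op_lambda b x \<in> carrier B"
  by (simp add: op_lambda_def a_minus_def)

lemma op_lambda_add:
  assumes "b \<in> carrier B" "x \<in> carrier B" "y \<in> carrier B"
  shows "op_lambda b (x \<oplus> y) = op_lambda b x \<oplus> op_lambda b y"
  using assms by (simp add: op_lambda_def left_compat add_group_simps)

text \<open>Splitting off an additive conjugation lets invariance under \<open>brace_lambda\<close>
  and \<open>op_lambda\<close> together yield additive normality.\<close>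

lemma op_lambda_eq_conj:
  "b \<in> carrier B \<Longrightarrow> x \<in> carrier B \<Longrightarrow> op_lambda b x = b \<oplus> brace_lambda B b x \<oplus> \<ominus> b"
  by (simp add: op_lambda_def add_lambda a_minus_def)

lemma op_lambda_mult:
  assumes "a \<in> carrier B" "b \<in> carrier B" "x \<in> carrier B"
  shows "op_lambda (a \<otimes> b) x = op_lambda a (op_lambda b x)"
proof -
  have "(a \<otimes> b) \<otimes> x = a \<otimes> (op_lambda b x \<oplus> b)"
    using assms by (simp add: op_lambda_def add_group_simps mult.m_assoc)
  also have "\<dots> = a \<otimes> op_lambda b x \<ominus> a \<oplus> a \<otimes> b"
    using assms by (intro left_compat) (auto simp: op_lambda_closed)
  finally show ?thesis
    using assms by (simp add: op_lambda_def[of "a \<otimes> b"] op_lambda_def[of a]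
        op_lambda_closed add_group_simps)
qed

section \<open>Ideals in terms of elements\<close>

text \<open>Inclusion suffices for the \<open>\<lambda>\<close>-condition because
  \<open>\<lambda>\<close> of \<open>inv b\<close> supplies preimages. Multiplicative closure comes
  from \<open>a b = a + \<lambda>\<^sub>a(b)\<close>, and \<open>inv a\<close> is the negative of
  the image of a under \<open>\<lambda>\<close> of \<open>inv a\<close>.\<close>

lemma brace_idealI:
  assumes "subgroup N (add_monoid B)"
    and lam: "\<And>b x. b \<in> carrier B \<Longrightarrow> x \<in> N \<Longrightarrow> brace_lambda B b x \<in> N"
    and add: "\<And>b x. b \<in> carrier B \<Longrightarrow> x \<in> N \<Longrightarrow> b \<oplus> x \<oplus> \<ominus> b \<in> N"
    and mult: "\<And>b x. b \<in> carrier B \<Longrightarrow> x \<in> N \<Longrightarrow> b \<otimes> x \<otimes> inv b \<in> N"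
  shows "brace_ideal B N"
proof -
  interpret N: subgroup N "add_monoid B" by fact
  have sub: "N \<subseteq> carrier B" using N.subset by simp
  have mN: "x \<oplus> y \<in> N" if "x \<in> N" "y \<in> N" for x y
    using N.m_closed that by simp
  have iN: "\<ominus> x \<in> N" if "x \<in> N" for x
    using N.m_inv_closed that by (simp add: a_inv_def)
  have "brace_lambda B b ` N = N" if "b \<in> carrier B" for b
  proof
    show "N \<subseteq> brace_lambda B b ` N"
    proof
      fix x assume x: "x \<in> N"
      then have "x = brace_lambda B b (brace_lambda B (inv b) x)"
        using that sub lambda_inv[of b x] by auto
      then show "x \<in> brace_lambda B b ` N"
        using lam[of "inv b" x] that x by blast
    qed
  qed (use lam that in auto)
  moreover have "N \<lhd> add_monoid B"
    using assms(1) add by (auto simp: add.normal_inv_iff)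
  moreover have "N \<lhd> B"
  proof -
    have "subgroup N B"
    proof (rule mult.subgroupI)
      show "N \<noteq> {}" using N.one_closed by auto
      show "inv a \<in> N" if "a \<in> N" for a
      proof -
        have a: "a \<in> carrier B" using that sub by auto
        have "brace_lambda B (inv a) a = \<ominus> (inv a)"
          using a by (simp add: brace_lambda_def one_eq_zero)
        then have "\<ominus> (inv a) \<in> N" using lam[of "inv a" a] a that by simp
        then show ?thesis using iN[of "\<ominus> (inv a)"] a by simp
      qed
      show "a \<otimes> b \<in> N" if "a \<in> N" "b \<in> N" for a b
      proof -
        have C: "a \<in> carrier B" "b \<in> carrier B" using that sub by auto
        then have "a \<oplus> brace_lambda B a b \<in> N" using that mN lam by blast
        then show ?thesis using C by (simp add: add_lambda)
      qed
    qed (rule sub)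
    then show ?thesis using mult by (auto simp: mult.normal_inv_iff)
  qed
  ultimately show ?thesis
    using assms(1) by (simp add: brace_ideal_def left_brace_ideal_def)
qed

lemma brace_idealD:
  assumes "brace_ideal B N"
  shows "N \<subseteq> carrier B" "\<zero> \<in> N" "subgroup N (add_monoid B)"
    and "\<And>x y. x \<in> N \<Longrightarrow> y \<in> N \<Longrightarrow> x \<oplus> y \<in> N"
    and "\<And>x. x \<in> N \<Longrightarrow> \<ominus> x \<in> N"
    and "\<And>x y. x \<in> N \<Longrightarrow> y \<in> N \<Longrightarrow> x \<otimes> y \<in> N"
    and "\<And>b x. b \<in> carrier B \<Longrightarrow> x \<in> N \<Longrightarrow> brace_lambda B b x \<in> N"
    and "\<And>b x. b \<in> carrier B \<Longrightarrow> x \<in> N \<Longrightarrow> b \<oplus> x \<oplus> \<ominus> b \<in> N"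
    and "\<And>b x. b \<in> carrier B \<Longrightarrow> x \<in> N \<Longrightarrow> b \<otimes> x \<otimes> inv b \<in> N"
proof -
  show s: "subgroup N (add_monoid B)"
    using assms by (simp add: brace_ideal_def left_brace_ideal_def)
  interpret N: subgroup N "add_monoid B" by fact
  show "N \<subseteq> carrier B" using N.subset by simp
  show "\<zero> \<in> N" using N.one_closed by simp
  show "x \<oplus> y \<in> N" if "x \<in> N" "y \<in> N" for x y
    using N.m_closed that by simp
  show "\<ominus> x \<in> N" if "x \<in> N" for x
    using N.m_inv_closed that by (simp add: a_inv_def)
  show "brace_lambda B b x \<in> N" if "b \<in> carrier B" "x \<in> N" for b x
    using assms that by (auto simp: brace_ideal_def left_brace_ideal_def)
  show "b \<oplus> x \<oplus> \<ominus> b \<in> N" if "b \<in> carrier B" "x \<in> N" for b x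
    using assms that by (auto simp: brace_ideal_def add.normal_inv_iff)
  have n: "N \<lhd> B" using assms by (simp add: brace_ideal_def)
  then show "b \<otimes> x \<otimes> inv b \<in> N" if "b \<in> carrier B" "x \<in> N" for b x
    using that by (auto simp: mult.normal_inv_iff)
  show "x \<otimes> y \<in> N" if "x \<in> N" "y \<in> N" for x y
    using n that by (auto simp: mult.normal_inv_iff subgroup.m_closed)
qed

lemma brace_ideal_carrier: "brace_ideal B (carrier B)"
  using add.subgroup_self by (intro brace_idealI) (auto simp: lambda_closed)

text \<open>Conjugating x - w by -w gives m in \<open>N\<close> with x = w + m. Writing m as
  \<open>\<lambda>\<^sub>w(l)\<close> with l in \<open>N\<close> turns this into x = w l, so the
  quotient is a conjugate of l. This passes from additive to multiplicative congruence.\<close>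

lemma brace_ideal_diff_imp_quotient:
  assumes N: "brace_ideal B N" and x: "x \<in> carrier B" and w: "w \<in> carrier B"
    and "x \<ominus> w \<in> N"
  shows "x \<otimes> inv w \<in> N"
proof -
  define m where "m = \<ominus> w \<oplus> x"
  have mc: "m \<in> carrier B" using x w by (simp add: m_def)
  have "m = \<ominus> w \<oplus> (x \<ominus> w) \<oplus> \<ominus> (\<ominus> w)"
    using x w by (simp add: m_def add_group_simps)
  also have "\<dots> \<in> N"
    using brace_idealD(8)[OF N, of "\<ominus> w"] assms by simp
  finally have m: "m \<in> N" .
  define l where "l = brace_lambda B (inv w) m"
  have l: "l \<in> N" using brace_idealD(7)[OF N] m w by (simp add: l_def)
  have lc: "l \<in> carrier B" using l brace_idealD(1)[OF N] by auto
  have "x = w \<oplus> m" using x w by (simp add: m_def add_group_simps)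
  also have "\<dots> = w \<oplus> brace_lambda B w l" using lambda_inv[OF w mc] by (simp add: l_def)
  also have "\<dots> = w \<otimes> l" using add_lambda[OF w lc] .
  finally show ?thesis using brace_idealD(9)[OF N w l] by simp
qed

section \<open>The subgroup \<open>N(K)\<close> and the commutator ideal\<close>

text \<open>Multiplicative commutators are not listed: an ideal containing these elements contains
  them too, as shown in \<open>brace_commutator_subset\<close>.\<close>

definition commutator_gens :: "'a set \<Rightarrow> 'a set" where
  "commutator_gens K =
     {h \<oplus> k \<oplus> \<ominus> h \<oplus> \<ominus> k | h k. h \<in> K \<and> k \<in> K} \<union> {i \<otimes> j \<ominus> (i \<oplus> j) | i j. i \<in> K \<and> j \<in> K}"

definition additive_commutator :: "'a set \<Rightarrow> 'a set" where
  "additive_commutator K = generate (add_monoid B) (commutator_gens K)"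

lemma commutator_gensE:
  assumes "x \<in> commutator_gens K"
  obtains (add) h k where "h \<in> K" "k \<in> K" "x = h \<oplus> k \<oplus> \<ominus> h \<oplus> \<ominus> k"
    | (diff) i j where "i \<in> K" "j \<in> K" "x = i \<otimes> j \<ominus> (i \<oplus> j)"
  using assms unfolding commutator_gens_def by blast

lemma commutator_gens_mono: "J \<subseteq> K \<Longrightarrow> commutator_gens J \<subseteq> commutator_gens K"
  unfolding commutator_gens_def by blast

text \<open>The point is the multiplicative commutators. Modulo \<open>L\<close> the products h k
  and k h agree with h + k and k + h, which agree with each other; the additive congruence of h k
  and k h is then turned into a multiplicative one.\<close>

lemma brace_commutator_subset:
  assumes L: "brace_ideal B L" and J: "J \<subseteq> carrier B" and gens: "commutator_gens J \<subseteq> L"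
  shows "brace_commutator B J J \<subseteq> L"
proof -
  note L' = brace_idealD[OF L]
  have c: "h \<oplus> k \<oplus> \<ominus> h \<oplus> \<ominus> k \<in> L" if "h \<in> J" "k \<in> J" for h k
    using gens that unfolding commutator_gens_def by blast
  have d: "i \<otimes> j \<ominus> (i \<oplus> j) \<in> L" if "i \<in> J" "j \<in> J" for i j
    using gens that unfolding commutator_gens_def by blast
  have "commutator_subgroup (add_monoid B) J J \<subseteq> L"
    unfolding commutator_subgroup_def
    by (rule add.generate_subgroup_incl) (use c L'(3) in \<open>auto simp: a_inv_def[symmetric]\<close>)
  moreover have "commutator_subgroup B J J \<subseteq> L"
    unfolding commutator_subgroup_def
  proof (rule mult.generate_subgroup_incl)
    show "subgroup L B" using L by (auto simp: brace_ideal_def mult.normal_inv_iff)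
    have "h \<otimes> k \<otimes> inv h \<otimes> inv k \<in> L" if hk: "h \<in> J" "k \<in> J" for h k
    proof -
      have C: "h \<in> carrier B" "k \<in> carrier B" using hk J by auto
      have "h \<otimes> k \<ominus> k \<otimes> h = (h \<otimes> k \<ominus> (h \<oplus> k)) \<oplus> (h \<oplus> k \<oplus> \<ominus> h \<oplus> \<ominus> k) \<oplus> \<ominus> (k \<otimes> h \<ominus> (k \<oplus> h))"
        using C by (simp add: add_group_simps)
      also have "\<dots> \<in> L" using c d hk L'(4,5) by simp
      finally have "(h \<otimes> k) \<otimes> inv (k \<otimes> h) \<in> L"
        using brace_ideal_diff_imp_quotient[OF L] C by simp
      then show ?thesis using C by (simp add: mult.inv_mult_group mult.m_assoc)
    qed
    then show "{h \<otimes> k \<otimes> inv h \<otimes> inv k |h k. h \<in> J \<and> k \<in> J} \<subseteq> L" by blast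
  qed
  moreover have "{i \<otimes> j \<ominus> (i \<oplus> j) | i j. i \<in> J \<and> j \<in> J} \<subseteq> L" using d by blast
  ultimately show ?thesis
    unfolding brace_commutator_def brace_ideal_generated_def using L by blast
qed

text \<open>An abstract \<open>f\<close>, additive in x and multiplicative in b, covers
  \<open>brace_lambda\<close> and \<open>op_lambda\<close> at once. The identity b i = (b i inv b) b
  moves \<open>f b\<close> past \<open>f i\<close>.\<close>

lemma action_diff:
  assumes closed: "\<And>b x. b \<in> carrier B \<Longrightarrow> x \<in> carrier B \<Longrightarrow> f b x \<in> carrier B"
    and add: "\<And>b x y. b \<in> carrier B \<Longrightarrow> x \<in> carrier B \<Longrightarrow> y \<in> carrier B
               \<Longrightarrow> f b (x \<oplus> y) = f b x \<oplus> f b y"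
    and mult: "\<And>a b x. a \<in> carrier B \<Longrightarrow> b \<in> carrier B \<Longrightarrow> x \<in> carrier B
               \<Longrightarrow> f (a \<otimes> b) x = f a (f b x)"
    and C: "b \<in> carrier B" "i \<in> carrier B" "j \<in> carrier B"
  shows "f b (\<ominus> j) = \<ominus> f b j"
    and "f b (f i j \<ominus> j) = f (b \<otimes> i \<otimes> inv b) (f b j) \<ominus> f b j"
proof -
  have "f b \<zero> \<oplus> f b \<zero> = f b \<zero>" using add[of b \<zero> \<zero>] C by simp
  then have "f b \<zero> = \<zero>" using closed[of b \<zero>] C by simp
  then have "f b j \<oplus> f b (\<ominus> j) = \<zero>" using add[of b j "\<ominus> j"] C by simp
  then show inv: "f b (\<ominus> j) = \<ominus> f b j"
    using closed C by (metis add.inv_closed add.inv_equality add.inv_comm)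
  have "f (b \<otimes> i \<otimes> inv b) (f b j) = f (b \<otimes> i \<otimes> inv b \<otimes> b) j"
    using mult C by simp
  also have "\<dots> = f b (f i j)" using mult C by (simp add: mult.m_assoc)
  finally show "f b (f i j \<ominus> j) = f (b \<otimes> i \<otimes> inv b) (f b j) \<ominus> f b j"
    using add C closed inv by (simp add: a_minus_def)
qed

lemma commutator_gens_carrier: "K \<subseteq> carrier B \<Longrightarrow> commutator_gens K \<subseteq> carrier B"
  unfolding commutator_gens_def by (auto simp: minus_closed subset_eq)

text \<open>The image of a generated subgroup is generated by the images, so invariance need only be
  checked on \<open>S\<close>.\<close>

lemma generate_image_subset:
  assumes "S \<subseteq> carrier B" "\<And>x. x \<in> carrier B \<Longrightarrow> f x \<in> carrier B"
    and "\<And>x y. x \<in> carrier B \<Longrightarrow> y \<in> carrier B \<Longrightarrow> f (x \<oplus> y) = f x \<oplus> f y"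
    and "\<And>x. x \<in> S \<Longrightarrow> f x \<in> generate (add_monoid B) S"
    and "x \<in> generate (add_monoid B) S"
  shows "f x \<in> generate (add_monoid B) S"
proof -
  interpret f: group_hom "add_monoid B" "add_monoid B" f
    using assms add.group_axioms
    by (simp add: group_hom_def group_hom_axioms_def hom_def add_group)
  have "f ` generate (add_monoid B) S = generate (add_monoid B) (f ` S)"
    using assms by (simp add: f.generate_img)
  also have "\<dots> \<subseteq> generate (add_monoid B) S"
    using assms by (intro add.generate_subgroup_incl add.generate_is_subgroup) auto
  finally show ?thesis using assms by blast
qed

end

section \<open>\<open>N(K)\<close> is an ideal of a two-sided skew brace\<close>

context two_sided_skew_brace
begin

text \<open>Two-sidedness enters here. With d = c x - c, left compatibility gives c (x + y) = d + c
  y. Multiplying by \<open>inv c\<close> on the right produces the term d inv c - inv c, which is c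
  x inv c because c inv c = 1 = 0.\<close>

lemma mult_conj_add:
  assumes C: "c \<in> carrier B" "x \<in> carrier B" "y \<in> carrier B"
  shows "c \<otimes> (x \<oplus> y) \<otimes> inv c = c \<otimes> x \<otimes> inv c \<oplus> c \<otimes> y \<otimes> inv c"
proof -
  let ?d = "c \<otimes> x \<ominus> c"
  have D: "?d \<in> carrier B" using C by (simp add: minus_closed)
  have "c \<otimes> x \<otimes> inv c = (?d \<oplus> c) \<otimes> inv c"
    using C by (simp add: add_group_simps)
  also have "\<dots> = ?d \<otimes> inv c \<ominus> inv c"
    using right_compat[of ?d c "inv c"] C D by (simp add: one_eq_zero a_minus_def)
  finally have "c \<otimes> x \<otimes> inv c = ?d \<otimes> inv c \<ominus> inv c" .
  moreover have "(?d \<oplus> c \<otimes> y) \<otimes> inv c = ?d \<otimes> inv c \<ominus> inv c \<oplus> c \<otimes> y \<otimes> inv c"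
    using right_compat C D by simp
  ultimately show ?thesis using C left_compat by simp
qed

lemma brace_ideal_additive_commutator:
  assumes K: "brace_ideal B K"
  shows "brace_ideal B (additive_commutator K)" "additive_commutator K \<subseteq> K"
proof -
  note K' = brace_idealD[OF K]
  let ?N = "additive_commutator K"
  have gc: "commutator_gens K \<subseteq> carrier B" using commutator_gens_carrier K'(1) .
  have N: "subgroup ?N (add_monoid B)"
    unfolding additive_commutator_def using gc by (intro add.generate_is_subgroup) simp
  then interpret N: subgroup ?N "add_monoid B" .
  have mN: "x \<oplus> y \<in> ?N" if "x \<in> ?N" "y \<in> ?N" for x y
    using N.m_closed that by simp
  have "commutator_gens K \<subseteq> K"
    unfolding commutator_gens_def using K'(4-6) by (auto simp: a_minus_def)
  then show NK: "?N \<subseteq> K"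
    unfolding additive_commutator_def using K'(3) by (intro add.generate_subgroup_incl)
  have gN: "x \<in> ?N" if "x \<in> commutator_gens K" for x
    using that generate.incl unfolding additive_commutator_def by metis
  have com: "h \<oplus> k \<oplus> \<ominus> h \<oplus> \<ominus> k \<in> ?N" if "h \<in> K" "k \<in> K" for h k
    using that by (intro gN) (auto simp: commutator_gens_def)
  have dif: "i \<otimes> j \<ominus> (i \<oplus> j) \<in> ?N" if "i \<in> K" "j \<in> K" for i j
    using that by (intro gN) (auto simp: commutator_gens_def)
  \<comment> \<open>Since n lies in \<open>K\<close>, k + n - k differs from n by a commutator of
    elements of \<open>K\<close>. Conjugation by arbitrary elements of the carrier is treated at the
    end.\<close>
  have conj: "k \<oplus> n \<oplus> \<ominus> k \<in> ?N" if "k \<in> K" "n \<in> ?N" for k n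
  proof -
    have "k \<oplus> n \<oplus> \<ominus> k = (k \<oplus> n \<oplus> \<ominus> k \<oplus> \<ominus> n) \<oplus> n"
      using that NK K'(1) by (simp add: add_group_simps subset_eq)
    also have "\<dots> \<in> ?N" using mN[OF com that(2)] that NK by blast
    finally show ?thesis .
  qed
  \<comment> \<open>One argument for both actions: \<open>diff\<close> puts f i j - j into
    \<open>N(K)\<close>, and \<open>split\<close> recovers i j - (i + j) from it by a conjugation
    with an element of \<open>K\<close> and a commutator.\<close>
  have invariant: "f b x \<in> ?N"
    if closed: "\<And>b x. b \<in> carrier B \<Longrightarrow> x \<in> carrier B \<Longrightarrow> f b x \<in> carrier B"
    and add: "\<And>b x y. b \<in> carrier B \<Longrightarrow> x \<in> carrier B \<Longrightarrow> y \<in> carrier B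
               \<Longrightarrow> f b (x \<oplus> y) = f b x \<oplus> f b y"
    and mult: "\<And>a b x. a \<in> carrier B \<Longrightarrow> b \<in> carrier B \<Longrightarrow> x \<in> carrier B
               \<Longrightarrow> f (a \<otimes> b) x = f a (f b x)"
    and fK: "\<And>b x. b \<in> carrier B \<Longrightarrow> x \<in> K \<Longrightarrow> f b x \<in> K"
    and diff: "\<And>i j. i \<in> K \<Longrightarrow> j \<in> K \<Longrightarrow> f i j \<ominus> j \<in> ?N"
    and split: "\<And>i j. i \<in> K \<Longrightarrow> j \<in> K \<Longrightarrow> \<exists>g\<in>K. \<exists>h\<in>K. \<exists>k\<in>K.
         i \<otimes> j \<ominus> (i \<oplus> j) = (g \<oplus> (f i j \<ominus> j) \<oplus> \<ominus> g) \<oplus> (h \<oplus> k \<oplus> \<ominus> h \<oplus> \<ominus> k)"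
    and b: "b \<in> carrier B" and x: "x \<in> ?N" for f b x
    unfolding additive_commutator_def
  proof (rule generate_image_subset[OF gc, of "f b"])
    note inv = action_diff(1)[of f, OF closed add mult b b]
    note act = action_diff(2)[of f, OF closed add mult b]
    have fcom: "f b (h \<oplus> k \<oplus> \<ominus> h \<oplus> \<ominus> k) \<in> ?N" if "h \<in> K" "k \<in> K" for h k
      using com[of "f b h" "f b k"] fK add b inv that K'(1) by (simp add: subset_eq)
    have fdif: "f b (i \<otimes> j \<ominus> (i \<oplus> j)) \<in> ?N" if ij: "i \<in> K" "j \<in> K" for i j
    proof -
      obtain g h k where ghk: "g \<in> K" "h \<in> K" "k \<in> K" and
        eq: "i \<otimes> j \<ominus> (i \<oplus> j) = (g \<oplus> (f i j \<ominus> j) \<oplus> \<ominus> g) \<oplus> (h \<oplus> k \<oplus> \<ominus> h \<oplus> \<ominus> k)"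
        using split[OF ij] by blast
      have C: "i \<in> carrier B" "j \<in> carrier B" "g \<in> carrier B" "h \<in> carrier B" "k \<in> carrier B"
        using ij ghk K'(1) by auto
      have "f b (i \<otimes> j \<ominus> (i \<oplus> j)) = (f b g \<oplus> f b (f i j \<ominus> j) \<oplus> \<ominus> f b g) \<oplus> f b (h \<oplus> k \<oplus> \<ominus> h \<oplus> \<ominus> k)"
        unfolding eq using C b add inv closed by (simp add: minus_closed)
      \<comment> \<open>By \<open>act\<close> this is again a difference covered by
        \<open>diff\<close>, now for b i inv b, which lies in \<open>K\<close> by normality, and f b
        j.\<close>
      moreover have "f b (f i j \<ominus> j) \<in> ?N"
        using act[of i j] C ij diff[of "b \<otimes> i \<otimes> inv b" "f b j"] fK b K'(9) by simp
      ultimately show ?thesis using conj fcom fK mN ghk b by simp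
    qed
    show "f b x \<in> generate (add_monoid B) (commutator_gens K)" if "x \<in> commutator_gens K" for x
      using that fcom fdif unfolding additive_commutator_def[symmetric]
      by (auto elim!: commutator_gensE)
  qed (use closed add b x in \<open>auto simp: additive_commutator_def\<close>)
  have lam: "brace_lambda B b x \<in> ?N" if "b \<in> carrier B" "x \<in> ?N" for b x
  proof (rule invariant[OF lambda_closed lambda_add lambda_mult K'(7) _ _ that])
    fix i j assume ij: "i \<in> K" "j \<in> K"
    then have C: "i \<in> carrier B" "j \<in> carrier B" using K'(1) by auto
    \<comment> \<open>The difference is the generator conjugated by -i; conversely
      \<open>split\<close> holds with g = i and the trivial commutator h = k = 0.\<close>
    have "brace_lambda B i j \<ominus> j = \<ominus> i \<oplus> (i \<otimes> j \<ominus> (i \<oplus> j)) \<oplus> \<ominus> (\<ominus> i)"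
      using C by (simp add: brace_lambda_def add_group_simps)
    then show "brace_lambda B i j \<ominus> j \<in> ?N"
      using conj[OF K'(5) dif] ij by simp
    have "i \<otimes> j \<ominus> (i \<oplus> j) = (i \<oplus> (brace_lambda B i j \<ominus> j) \<oplus> \<ominus> i) \<oplus> (\<zero> \<oplus> \<zero> \<oplus> \<ominus> \<zero> \<oplus> \<ominus> \<zero>)"
      using C by (simp add: brace_lambda_def add_group_simps)
    then show "\<exists>g\<in>K. \<exists>h\<in>K. \<exists>k\<in>K. i \<otimes> j \<ominus> (i \<oplus> j) =
        (g \<oplus> (brace_lambda B i j \<ominus> j) \<oplus> \<ominus> g) \<oplus> (h \<oplus> k \<oplus> \<ominus> h \<oplus> \<ominus> k)"
      using ij K'(2) by blast
  qed
  have op: "op_lambda b x \<in> ?N" if "b \<in> carrier B" "x \<in> ?N" for b x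
  proof (rule invariant[OF op_lambda_closed op_lambda_add op_lambda_mult _ _ _ that])
    show "op_lambda b x \<in> K" if "b \<in> carrier B" "x \<in> K" for b x
      using that K'(1,7,8) by (auto simp: op_lambda_eq_conj)
    fix i j assume ij: "i \<in> K" "j \<in> K"
    then have C: "i \<in> carrier B" "j \<in> carrier B" using K'(1) by auto
    \<comment> \<open>Here the difference is i j - i - j, so only the last two terms change order:
      by the commutator of i and j, and for \<open>split\<close> by that of j and i, with g =
      0.\<close>
    have "op_lambda i j \<ominus> j = (i \<otimes> j \<ominus> (i \<oplus> j)) \<oplus> (i \<oplus> j \<oplus> \<ominus> i \<oplus> \<ominus> j)"
      using C by (simp add: op_lambda_def add_group_simps)
    then show "op_lambda i j \<ominus> j \<in> ?N"
      using mN dif com ij by simp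
    have "i \<otimes> j \<ominus> (i \<oplus> j) = (\<zero> \<oplus> (op_lambda i j \<ominus> j) \<oplus> \<ominus> \<zero>) \<oplus> (j \<oplus> i \<oplus> \<ominus> j \<oplus> \<ominus> i)"
      using C by (simp add: op_lambda_def add_group_simps)
    then show "\<exists>g\<in>K. \<exists>h\<in>K. \<exists>k\<in>K. i \<otimes> j \<ominus> (i \<oplus> j) =
        (g \<oplus> (op_lambda i j \<ominus> j) \<oplus> \<ominus> g) \<oplus> (h \<oplus> k \<oplus> \<ominus> h \<oplus> \<ominus> k)"
      using ij K'(2) by blast
  qed
  show "brace_ideal B ?N"
  proof (rule brace_idealI[OF N lam])
    fix b x assume b: "b \<in> carrier B" and x: "x \<in> ?N"
    then have xc: "x \<in> carrier B" using NK K'(1) by auto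
    \<comment> \<open>In this composite \<open>\<lambda>\<^sub>b\<close> cancels against
      \<open>\<lambda>\<close> of \<open>inv b\<close>, leaving additive conjugation by b.\<close>
    have "op_lambda b (brace_lambda B (inv b) x) \<in> ?N" using b x lam op by simp
    then show "b \<oplus> x \<oplus> \<ominus> b \<in> ?N"
      using b xc by (simp add: op_lambda_eq_conj lambda_closed lambda_inv)
    \<comment> \<open>This map preserves both operations, hence sends a generator formed from
      elements of \<open>K\<close> to the one formed from their conjugates, again in
      \<open>K\<close>.\<close>
    let ?f = "\<lambda>x. b \<otimes> x \<otimes> inv b"
    have add: "?f (x \<oplus> y) = ?f x \<oplus> ?f y" if "x \<in> carrier B" "y \<in> carrier B" for x y
      using mult_conj_add b that by simp
    have "?f \<zero> = \<zero>" using b by (simp add: one_eq_zero[symmetric])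
    then have inv: "?f (\<ominus> x) = \<ominus> ?f x" if "x \<in> carrier B" for x
      using add[of "\<ominus> x" x] b that
      by (metis add.inv_closed add.inv_equality add.l_inv mult.inv_closed mult.m_closed)
    have mul: "?f (x \<otimes> y) = ?f x \<otimes> ?f y" if "x \<in> carrier B" "y \<in> carrier B" for x y
    proof -
      have "inv b \<otimes> (b \<otimes> z) = z" if "z \<in> carrier B" for z
        using b that by (simp add: mult.m_assoc[symmetric])
      then show ?thesis using b that by (simp add: mult.m_assoc)
    qed
    show "?f x \<in> ?N" unfolding additive_commutator_def
    proof (rule generate_image_subset[OF gc, of ?f])
      fix x assume "x \<in> commutator_gens K"
      then show "?f x \<in> generate (add_monoid B) (commutator_gens K)"
        unfolding additive_commutator_def[symmetric]
      proof (cases rule: commutator_gensE)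
        case 1: (add h k)
        have C: "h \<in> carrier B" "k \<in> carrier B" using 1 K'(1) by auto
        then have "?f x = ?f h \<oplus> ?f k \<oplus> \<ominus> ?f h \<oplus> \<ominus> ?f k"
          unfolding 1 by (simp only: add inv add.inv_closed add.m_closed)
        then show "?f x \<in> ?N" using com 1 K'(9) b by simp
      next
        case 2: (diff i j)
        have C: "i \<in> carrier B" "j \<in> carrier B" using 2 K'(1) by auto
        then have "?f x = ?f i \<otimes> ?f j \<ominus> (?f i \<oplus> ?f j)"
          unfolding 2 by (simp only: a_minus_def add inv mul add.inv_closed add.m_closed mult.m_closed)
        then show "?f x \<in> ?N" using dif 2 K'(9) b by simp
      qed
    qed (use b x add in \<open>auto simp: additive_commutator_def\<close>)
  qed auto
qed

end

section \<open>Derived series and commutators inside a subgroup\<close>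

context skew_brace
begin

lemma zero_in_brace_derived: "\<zero> \<in> brace_derived B n"
  using brace_idealD(2)
  by (cases n) (auto simp: brace_commutator_def brace_ideal_generated_def)

text \<open>The whole carrier is an ideal, so it takes part in the intersection defining each
  commutator.\<close>

lemma brace_derived_subset: "brace_derived B n \<subseteq> carrier B"
proof (induction n)
  case (Suc n)
  show ?case
    using brace_commutator_subset[OF brace_ideal_carrier Suc] commutator_gens_carrier[OF Suc] by simp
qed simp

text \<open>An ideal \<open>L\<close> of the restriction to \<open>I\<close> is an additive subgroup
  of \<open>B\<close>, so once it contains the generators it contains all they generate additively
  in \<open>B\<close>.\<close>

lemma additive_commutator_subset_brace_commutator:
  assumes I: "subgroup I (add_monoid B)" and J: "J \<subseteq> I" "J \<subseteq> E"
  shows "additive_commutator J \<subseteq> brace_commutator (B\<lparr>carrier := I\<rparr>) E E"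
  unfolding brace_commutator_def brace_ideal_generated_def additive_commutator_def
proof (rule Inter_greatest, clarify)
  interpret I: subgroup I "add_monoid B" by fact
  let ?C = "B\<lparr>carrier := I\<rparr>"
  fix L x
  assume L: "brace_ideal ?C L" and gens:
    "commutator_subgroup (add_monoid ?C) E E \<union> commutator_subgroup ?C E E \<union>
       {i \<otimes>\<^bsub>?C\<^esub> j \<ominus>\<^bsub>?C\<^esub> (i \<oplus>\<^bsub>?C\<^esub> j) |i j. i \<in> E \<and> j \<in> E} \<subseteq> L"
    and x: "x \<in> generate (add_monoid B) (commutator_gens J)"
  have inv: "\<ominus>\<^bsub>?C\<^esub> x = \<ominus> x" if "x \<in> I" for x
    using add.m_inv_consistent[OF I that] by (simp add: a_inv_def)
  have "subgroup L ((add_monoid B)\<lparr>carrier := I\<rparr>)"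
    using L by (simp add: brace_ideal_def left_brace_ideal_def)
  then have LB: "subgroup L (add_monoid B)"
    using add.incl_subgroup[OF I] by simp
  have "commutator_gens J \<subseteq> L"
  proof
    fix x assume "x \<in> commutator_gens J"
    then show "x \<in> L"
    proof (cases rule: commutator_gensE)
      case 1: (add h k)
      have "h \<oplus> k \<oplus> \<ominus>\<^bsub>?C\<^esub> h \<oplus> \<ominus>\<^bsub>?C\<^esub> k \<in> commutator_subgroup (add_monoid ?C) E E"
        unfolding commutator_subgroup_def using 1 J
        by (intro generate.incl) (auto simp: a_inv_def)
      then show ?thesis using 1 gens J inv by (auto simp: subset_eq)
    next
      case 2: (diff i j)
      \<comment> \<open>Negation in the restriction is identified with negation in \<open>B\<close>
        on elements of \<open>I\<close>, and i + j is negated below.\<close>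
      have "i \<oplus> j \<in> I" using 2 J I.m_closed[of i j] by auto
      moreover have "i \<otimes>\<^bsub>?C\<^esub> j \<ominus>\<^bsub>?C\<^esub> (i \<oplus>\<^bsub>?C\<^esub> j) \<in> L"
        using 2(1,2) gens J by blast
      ultimately show ?thesis using 2 inv by (simp add: a_minus_def)
    qed
  qed
  then show "x \<in> L" using x add.generate_subgroup_incl[OF _ LB] by auto
qed

section \<open>Passage to the quotient\<close>

text \<open>The coset map respects both operations and is onto, so the quotient inherits both group
  structures as a homomorphic image.\<close>

lemma Quot_group_hom:
  assumes I: "brace_ideal B I"
  shows "group_hom (add_monoid B) (add_monoid (B Quot I)) (\<lambda>x. I +> x)"
    and "group_hom B (B Quot I) (\<lambda>x. I +> x)"
proof -
  let ?p = "\<lambda>x. I +> x" and ?Q = "B Quot I"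
  have car: "carrier ?Q = ?p ` carrier B"
    by (auto simp: FactRing_def A_RCOSETS_def RCOSETS_def a_r_coset_def)
  interpret n: normal I "add_monoid B"
    using I by (simp add: brace_ideal_def)
  have one: "\<one>\<^bsub>?Q\<^esub> = ?p \<one>" by (simp add: FactRing_def)
  have "\<zero>\<^bsub>?Q\<^esub> = I" by (simp add: FactRing_def)
  also have "I = ?p \<zero>"
    using add.coset_mult_one[of I] brace_idealD(1)[OF I] by (simp add: a_r_coset_def)
  finally have zero: "\<zero>\<^bsub>?Q\<^esub> = ?p \<zero>" .
  have ha: "?p \<in> hom (add_monoid B) (add_monoid ?Q)"
    using Quot_add[OF I] by (auto simp: hom_def car)
  have hm: "?p \<in> hom B ?Q"
    using Quot_mult[OF I] by (auto simp: hom_def car)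
  have "group (add_monoid ?Q)"
    using add.hom_imp_img_group[OF ha] by (simp add: car[symmetric] zero[symmetric])
  moreover have "group ?Q"
    using mult.hom_imp_img_group[OF hm] by (simp add: car[symmetric] one[symmetric])
  ultimately show "group_hom (add_monoid B) (add_monoid ?Q) ?p" "group_hom B ?Q ?p"
    using ha hm add_group mult_group by (auto simp: group_hom_def group_hom_axioms_def)
qed

text \<open>Commutators in the quotient are intersections of ideals; pulling these back makes them
  comparable with ideals of \<open>B\<close>.\<close>

lemma brace_ideal_vimage_Quot:
  assumes I: "brace_ideal B I" and L: "brace_ideal (B Quot I) L"
  shows "brace_ideal B {x \<in> carrier B. I +> x \<in> L}"
proof -
  let ?Q = "B Quot I"
  interpret a: group_hom "add_monoid B" "add_monoid ?Q" "\<lambda>x. I +> x"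
    by (rule Quot_group_hom[OF I])
  interpret m: group_hom B ?Q "\<lambda>x. I +> x"
    by (rule Quot_group_hom[OF I])
  have La: "L \<lhd> add_monoid ?Q" and Lm: "L \<lhd> ?Q"
    and Ll: "\<And>b x. b \<in> carrier ?Q \<Longrightarrow> x \<in> L \<Longrightarrow> brace_lambda ?Q b x \<in> L"
    using L by (auto simp: brace_ideal_def left_brace_ideal_def)
  interpret La: normal L "add_monoid ?Q" by fact
  have inv: "I +> (\<ominus> x) = \<ominus>\<^bsub>?Q\<^esub> (I +> x)" if "x \<in> carrier B" for x
    using a.hom_inv[of x] that by (simp add: a_inv_def)
  note hom_simps = inv Quot_add[OF I, symmetric] Quot_mult[OF I, symmetric]
  have cl: "I +> x \<in> carrier ?Q" if "x \<in> carrier B" for x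
    using m.hom_closed that .
  show ?thesis
  proof (rule brace_idealI)
    show "subgroup {x \<in> carrier B. I +> x \<in> L} (add_monoid B)"
    proof (rule add.subgroupI)
      show "{x \<in> carrier B. I +> x \<in> L} \<noteq> {}"
        using La.one_closed a.hom_one by force
    qed (use La.m_inv_closed La.m_closed in
        \<open>auto simp: hom_simps a_inv_def[of ?Q]\<close>)
    fix b x assume b: "b \<in> carrier B" and "x \<in> {x \<in> carrier B. I +> x \<in> L}"
    then have x: "x \<in> carrier B" "I +> x \<in> L" by auto
    have "I +> brace_lambda B b x = brace_lambda ?Q (I +> b) (I +> x)"
      using b x by (simp add: brace_lambda_def hom_simps)
    then show "brace_lambda B b x \<in> {x \<in> carrier B. I +> x \<in> L}"
      using Ll[OF cl[OF b] x(2)] b x by (simp add: lambda_closed)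
    have "I +> (b \<oplus> x \<oplus> \<ominus> b) = (I +> b) \<oplus>\<^bsub>?Q\<^esub> (I +> x) \<oplus>\<^bsub>?Q\<^esub> (\<ominus>\<^bsub>?Q\<^esub> (I +> b))"
      using b x by (simp add: hom_simps)
    also have "\<dots> \<in> L"
      using La.inv_op_closed2[of "I +> b"] cl[OF b] x by (simp add: a_inv_def)
    finally show "b \<oplus> x \<oplus> \<ominus> b \<in> {x \<in> carrier B. I +> x \<in> L}"
      using b x by simp
    have "I +> (b \<otimes> x \<otimes> inv b) = (I +> b) \<otimes>\<^bsub>?Q\<^esub> (I +> x) \<otimes>\<^bsub>?Q\<^esub> inv\<^bsub>?Q\<^esub> (I +> b)"
      using b x by (simp add: m.hom_mult)
    also have "\<dots> \<in> L"
      using normal.inv_op_closed2[OF Lm] cl[OF b] x by simp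
    finally show "b \<otimes> x \<otimes> inv b \<in> {x \<in> carrier B. I +> x \<in> L}"
      using b x by simp
  qed
qed

text \<open>For each ideal \<open>L\<close> of the quotient in the intersection defining the next
  term, the preimage is an ideal of \<open>B\<close> that contains the generators of term n by
  induction, hence contains term n + 1.\<close>

lemma brace_derived_Quot:
  assumes I: "brace_ideal B I" and "x \<in> brace_derived B n"
  shows "I +> x \<in> brace_derived (B Quot I) n"
  using assms(2)
proof (induction n arbitrary: x)
  case 0
  then show ?case using group_hom.hom_closed[OF Quot_group_hom(2)[OF I]] by simp
next
  case (Suc n)
  let ?Q = "B Quot I" and ?D = "brace_derived B n" and ?E = "brace_derived (B Quot I) n"
  interpret a: group_hom "add_monoid B" "add_monoid ?Q" "\<lambda>x. I +> x"
    by (rule Quot_group_hom[OF I])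
  have inv: "I +> (\<ominus> x) = \<ominus>\<^bsub>?Q\<^esub> (I +> x)" if "x \<in> carrier B" for x
    using a.hom_inv[of x] that by (simp add: a_inv_def)
  note hom_simps = inv Quot_add[OF I, symmetric] Quot_mult[OF I, symmetric]
  have "I +> x \<in> L" if L: "brace_ideal ?Q L" and gens:
    "commutator_subgroup (add_monoid ?Q) ?E ?E \<union> commutator_subgroup ?Q ?E ?E \<union>
       {i \<otimes>\<^bsub>?Q\<^esub> j \<ominus>\<^bsub>?Q\<^esub> (i \<oplus>\<^bsub>?Q\<^esub> j) |i j. i \<in> ?E \<and> j \<in> ?E} \<subseteq> L" for L
  proof -
    have "commutator_gens ?D \<subseteq> {x \<in> carrier B. I +> x \<in> L}"
    proof
      fix y assume y: "y \<in> commutator_gens ?D"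
      then have yc: "y \<in> carrier B"
        using commutator_gens_carrier[OF brace_derived_subset] by blast
      from y have "I +> y \<in> L"
      proof (cases rule: commutator_gensE)
        case 1: (add h k)
        have C: "h \<in> carrier B" "k \<in> carrier B" using 1 brace_derived_subset by auto
        have "I +> y = (I +> h) \<oplus>\<^bsub>?Q\<^esub> (I +> k) \<oplus>\<^bsub>?Q\<^esub> (\<ominus>\<^bsub>?Q\<^esub> (I +> h)) \<oplus>\<^bsub>?Q\<^esub> (\<ominus>\<^bsub>?Q\<^esub> (I +> k))"
          using C 1 by (simp add: hom_simps)
        also have "\<dots> \<in> commutator_subgroup (add_monoid ?Q) ?E ?E"
          unfolding commutator_subgroup_def using 1 Suc.IH
          by (intro generate.incl) (auto simp: a_inv_def)
        finally show ?thesis using gens by blast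
      next
        case 2: (diff i j)
        have C: "i \<in> carrier B" "j \<in> carrier B" using 2 brace_derived_subset by auto
        have "I +> y = (I +> i) \<otimes>\<^bsub>?Q\<^esub> (I +> j) \<ominus>\<^bsub>?Q\<^esub> ((I +> i) \<oplus>\<^bsub>?Q\<^esub> (I +> j))"
          using C 2 by (simp add: a_minus_def hom_simps del: add.inv_mult_group)
        also have "\<dots> \<in> L" using gens Suc.IH 2 by blast
        finally show ?thesis .
      qed
      with yc show "y \<in> {x \<in> carrier B. I +> x \<in> L}" by simp
    qed
    then have "brace_commutator B ?D ?D \<subseteq> {x \<in> carrier B. I +> x \<in> L}"
      by (rule brace_commutator_subset[OF brace_ideal_vimage_Quot[OF I L] brace_derived_subset])
    then show ?thesis using Suc.prems by auto
  qed
  then show ?case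
    by (auto simp: brace_commutator_def brace_ideal_generated_def)
qed

lemma brace_derived_subset_if_Quot:
  assumes I: "brace_ideal B I" and "brace_derived (B Quot I) m = {\<zero>\<^bsub>B Quot I\<^esub>}"
  shows "brace_derived B m \<subseteq> I"
proof
  fix x assume x: "x \<in> brace_derived B m"
  then have xc: "x \<in> carrier B" using brace_derived_subset by auto
  have "I +> x = I"
    using brace_derived_Quot[OF I x] assms(2) by (simp add: FactRing_def)
  then show "x \<in> I"
    using add.rcos_self[OF xc, of I] brace_idealD(3)[OF I] by (simp add: a_r_coset_def)
qed

text \<open>There is a single coset, so the derived series is trivial already at index 0.\<close>

lemma brace_solvable_Quot_carrier: "brace_solvable (B Quot carrier B)"
proof -
  have "carrier B +> x = carrier B" if "x \<in> carrier B" for x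
    using add.coset_join2[OF _ add.subgroup_self] that by (simp add: a_r_coset_def)
  then have "carrier (B Quot carrier B) = {\<zero>\<^bsub>B Quot carrier B\<^esub>}"
    using add.one_closed by (auto simp: FactRing_def A_RCOSETS_def RCOSETS_def a_r_coset_def)
  then show ?thesis unfolding brace_solvable_def by (intro exI[of _ 0]) simp
qed

end

section \<open>Comparison of the derived series of \<open>B\<close> and of \<open>I\<close>\<close>

text \<open>\<open>K\<close> is the n-fold iterate of \<open>additive_commutator\<close> on
  \<open>I\<close>. As an ideal of \<open>B\<close> it bounds the series of \<open>B\<close> from
  above. The shift \<open>m\<close> accounts for the steps that series takes to enter
  \<open>I\<close>.\<close>

lemma (in two_sided_skew_brace) brace_derived_between:
  assumes I: "brace_ideal B I" and m: "brace_derived B m \<subseteq> I"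
  shows "\<exists>K. brace_ideal B K \<and> K \<subseteq> I \<and> brace_derived B (n + m) \<subseteq> K \<and>
           K \<subseteq> brace_derived (B\<lparr>carrier := I\<rparr>) n"
proof (induction n)
  case 0
  then show ?case using I m by auto
next
  case (Suc n)
  then obtain K where K: "brace_ideal B K" "K \<subseteq> I" "brace_derived B (n + m) \<subseteq> K"
    "K \<subseteq> brace_derived (B\<lparr>carrier := I\<rparr>) n" by blast
  let ?N = "additive_commutator K"
  note N = brace_ideal_additive_commutator[OF K(1)]
  have "commutator_gens (brace_derived B (n + m)) \<subseteq> ?N"
    using commutator_gens_mono[OF K(3)] generate.incl[of _ "commutator_gens K"]
    unfolding additive_commutator_def by blast
  then have "brace_derived B (Suc n + m) \<subseteq> ?N"
    using brace_commutator_subset[OF N(1) brace_derived_subset] by simp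
  moreover have "?N \<subseteq> brace_derived (B\<lparr>carrier := I\<rparr>) (Suc n)"
    using additive_commutator_subset_brace_commutator[OF brace_idealD(3)[OF I] K(2,4)]
    by simp
  ultimately show ?case using N K(2) by blast
qed

theorem corollary4p6:
  fixes B :: "('a, 'b) ring_scheme"
  assumes "two_sided_skew_brace B"
  shows "brace_solvable B \<longleftrightarrow>
    (\<exists>I. brace_ideal B I \<and> brace_solvable (B\<lparr>carrier := I\<rparr>) \<and> brace_solvable (B Quot I))"
proof -
  interpret two_sided_skew_brace B by fact
  show ?thesis
  proof
    \<comment> \<open>The witness is the whole carrier: restricting to it gives back
      \<open>B\<close>, and the quotient is trivial.\<close>
    assume "brace_solvable B"
    then show "\<exists>I. brace_ideal B I \<and> brace_solvable (B\<lparr>carrier := I\<rparr>) \<and> brace_solvable (B Quot I)"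
      using brace_ideal_carrier brace_solvable_Quot_carrier by (intro exI[of _ "carrier B"]) simp
  next
    assume "\<exists>I. brace_ideal B I \<and> brace_solvable (B\<lparr>carrier := I\<rparr>) \<and> brace_solvable (B Quot I)"
    then obtain I n m where I: "brace_ideal B I"
      and n: "brace_derived (B\<lparr>carrier := I\<rparr>) n = {\<zero>\<^bsub>B\<^esub>}"
      and m: "brace_derived (B Quot I) m = {\<zero>\<^bsub>B Quot I\<^esub>}"
      by (auto simp: brace_solvable_def)
    \<comment> \<open>The intermediate ideal at index n contains this term and lies in the n-th
      derived term of \<open>I\<close>, which is 0.\<close>
    have "brace_derived B (n + m) \<subseteq> {\<zero>\<^bsub>B\<^esub>}"
      using brace_derived_between[OF I brace_derived_subset_if_Quot[OF I m], of n] n by auto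
    then have "brace_derived B (n + m) = {\<zero>\<^bsub>B\<^esub>}"
      using zero_in_brace_derived by auto
    then show "brace_solvable B" by (auto simp: brace_solvable_def)
  qed
qed

end
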